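(* Let $K$ be a compact linear operator on a complex Hilbert space. Then $K$ is not Li-Yorke chaotic. Consequently, $K$ is neither distributionally chaotic nor norm-unimodal.
   Context: Let $f:X\to X$ be a continuous map on a metric space $(X,d)$; for an operator on a Hilbert space, $d(x,y)=\|x-y\|$. Li-Yorke chaos: a pair $\{x,y\}\subset X$ is a Li-Yorke chaotic pair if $\limsup_{n\to\infty}d(f^n(x),f^n(y))>0$ and $\liminf_{n\to\infty}d(f^n(x),f^n(y))=0$. The map $f$ is Li-Yorke chaotic if there is an uncountable subset $\Gamma\subseteq X$ such that every pair of two distinct points of $\Gamma$ is a Li-Yorke chaotic pair. Distributional chaos: for $x,y\in X$, $n\ge 1$ and $\tau\in\mathbb{R}$, put $F^{n}_{xy}(\tau)=\frac1n\#\{0\le i\le n-1: d(f^i(x),f^i(y))<\tau\}$, $F_{xy}(\tau)=\liminf_{n\to\infty}F^n_{xy}(\tau)$ and $F^*_{xy}(\tau)=\limsup_{n\to\infty}F^n_{xy}(\tau)$. The pair $\{x,y\}$ is distributionally chaotic if $F^*_{xy}(\tau)=1$ for all $\tau>0$ and $F_{xy}(\epsilon)=0$ for some $\epsilon>0$. The map $f$ is distributionally chaotic if there is an uncountable subset $\Lambda\subseteq X$ such that every pair of two distinct points of $\Lambda$ is a distributionally chaotic pair. Norm-unimodality: a bounded linear operator $T$ on a Banach space $X$ is norm-unimodal if there is a constant $r>1$ such that for every $m\in\mathbb{N}$ there exists a nonzero vector $x_m\in X$ satisfying $\lim_{k\to\infty}\|T^k x_m\|=0$ and $\|T^i x_m\|\ge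 r^i\|x_m\|$ for $i=1,2,\ldots,m$. *)

theory Defs
  imports "HOL-Analysis.Analysis"
begin

text \<open>
  Complex Hilbert spaces. The underlying real Banach space supplies the norm, the metric and
  completeness; the axioms below say that its real structure is the restriction of a complex
  vector space structure and that its norm is induced by a complex inner product, linear in the
  first argument. Positive definiteness of the inner product is contained in
  \<open>cinner_self\<close>, because \<open>norm\<close> is a norm, and \<open>scaleC 1 x = x\<close> in \<open>scaleR_scaleC\<close>.
\<close>

class complex_hilbert_space = banach +
  fixes scaleC :: "complex \<Rightarrow> 'a \<Rightarrow> 'a"
    and cinner :: "'a \<Rightarrow> 'a \<Rightarrow> complex"
  assumes scaleC_add_right: "scaleC a (x + y) = scaleC a x + scaleC a y"
    and scaleC_add_left: "scaleC (a + b) x = scaleC a x + scaleC b x"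
    and scaleC_scaleC: "scaleC a (scaleC b x) = scaleC (a * b) x"
    and scaleR_scaleC: "scaleR r x = scaleC (complex_of_real r) x"
    and cinner_commute: "cinner x y = cnj (cinner y x)"
    and cinner_add_left: "cinner (x + y) z = cinner x z + cinner y z"
    and cinner_scaleC_left: "cinner (scaleC a x) y = a * cinner x y"
    and cinner_self: "cinner x x = complex_of_real ((norm x)\<^sup>2)"

lemma vector_space_scaleC:
  "vector_space (scaleC :: complex \<Rightarrow> 'a::complex_hilbert_space \<Rightarrow> 'a)"
proof
  fix x :: 'a
  show "scaleC 1 x = x"
    using scaleR_scaleC[of 1 x] by simp
qed (simp_all add: scaleC_add_right scaleC_add_left scaleC_scaleC)

instantiation complex :: complex_hilbert_space
begin

definition scaleC_complex :: "complex \<Rightarrow> complex \<Rightarrow> complex"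
  where "scaleC_complex a x = a * x"

definition cinner_complex :: "complex \<Rightarrow> complex \<Rightarrow> complex"
  where "cinner_complex x y = x * cnj y"

instance
proof
  show "cinner x x = complex_of_real ((norm x)\<^sup>2)" for x :: complex
    unfolding cinner_complex_def by (rule complex_norm_square[symmetric])
qed (simp_all add: scaleC_complex_def cinner_complex_def algebra_simps scaleR_conv_of_real)

end

definition compact_operator :: "('a::complex_hilbert_space \<Rightarrow> 'a) \<Rightarrow> bool"
  where "compact_operator K \<longleftrightarrow>
    Vector_Spaces.linear scaleC scaleC K \<and>
    (\<forall>S. bounded S \<longrightarrow> compact (closure (K ` S)))"

text \<open>
  The distance along two orbits may be unbounded, so its upper and lower limits are taken in the
  extended reals.
\<close>

definition li_yorke_pair :: "('a::metric_space \<Rightarrow> 'a) \<Rightarrow> 'a \<Rightarrow> 'a \<Rightarrow> bool"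
  where "li_yorke_pair f x y \<longleftrightarrow>
    limsup (\<lambda>n. ereal (dist ((f ^^ n) x) ((f ^^ n) y))) > 0 \<and>
    liminf (\<lambda>n. ereal (dist ((f ^^ n) x) ((f ^^ n) y))) = 0"

definition li_yorke_chaotic :: "('a::metric_space \<Rightarrow> 'a) \<Rightarrow> bool"
  where "li_yorke_chaotic f \<longleftrightarrow>
    (\<exists>\<Gamma>. uncountable \<Gamma> \<and> (\<forall>x\<in>\<Gamma>. \<forall>y\<in>\<Gamma>. x \<noteq> y \<longrightarrow> li_yorke_pair f x y))"

text \<open>
  Only \<open>n \<ge> 1\<close> is meaningful in \<open>orbit_freq\<close>; the value \<open>0\<close> at \<open>n = 0\<close> does not affect the
  limits below.
\<close>

definition orbit_freq :: "('a::metric_space \<Rightarrow> 'a) \<Rightarrow> 'a \<Rightarrow> 'a \<Rightarrow> nat \<Rightarrow> real \<Rightarrow> real"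
  where "orbit_freq f x y n \<tau> =
    real (card {i. i < n \<and> dist ((f ^^ i) x) ((f ^^ i) y) < \<tau>}) / real n"

definition lower_distribution :: "('a::metric_space \<Rightarrow> 'a) \<Rightarrow> 'a \<Rightarrow> 'a \<Rightarrow> real \<Rightarrow> ereal"
  where "lower_distribution f x y \<tau> = liminf (\<lambda>n. ereal (orbit_freq f x y n \<tau>))"

definition upper_distribution :: "('a::metric_space \<Rightarrow> 'a) \<Rightarrow> 'a \<Rightarrow> 'a \<Rightarrow> real \<Rightarrow> ereal"
  where "upper_distribution f x y \<tau> = limsup (\<lambda>n. ereal (orbit_freq f x y n \<tau>))"

definition distributionally_chaotic_pair :: "('a::metric_space \<Rightarrow> 'a) \<Rightarrow> 'a \<Rightarrow> 'a \<Rightarrow> bool"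
  where "distributionally_chaotic_pair f x y \<longleftrightarrow>
    (\<forall>\<tau>>0. upper_distribution f x y \<tau> = 1) \<and> (\<exists>\<epsilon>>0. lower_distribution f x y \<epsilon> = 0)"

definition distributionally_chaotic :: "('a::metric_space \<Rightarrow> 'a) \<Rightarrow> bool"
  where "distributionally_chaotic f \<longleftrightarrow>
    (\<exists>\<Lambda>. uncountable \<Lambda> \<and>
      (\<forall>x\<in>\<Lambda>. \<forall>y\<in>\<Lambda>. x \<noteq> y \<longrightarrow> distributionally_chaotic_pair f x y))"

text \<open>
  Continuity of \<open>f\<close> above and boundedness and linearity of \<open>T\<close> below are standing assumptions on
  the map, not part of the predicates; compact operators satisfy them.
\<close>

definition norm_unimodal :: "('a::banach \<Rightarrow> 'a) \<Rightarrow> bool"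
  where "norm_unimodal T \<longleftrightarrow>
    (\<exists>r>1. \<forall>m::nat. \<exists>x. x \<noteq> 0 \<and> (\<lambda>k. norm ((T ^^ k) x)) \<longlonglongrightarrow> 0 \<and>
      (\<forall>i\<in>{1..m}. norm ((T ^^ i) x) \<ge> r ^ i * norm x))"

end

theory Submission
  imports Defs
begin

text \<open>
  Fix \<open>\<sigma> n \<rightarrow> \<infinity>\<close> and let \<open>V\<close> be the \<open>K\<close>-invariant subspace of all \<open>y\<close> with \<open>K\<^bsup>\<sigma> n\<^esup> y \<rightarrow> 0\<close>.
  For \<open>\<bar>w\<bar> = 1\<close> the geometric sums \<open>u\<^sub>n = (\<Sum>j<n. w\<^sup>j K\<^sup>j y)\<close> satisfy \<open>(I - wK) u\<^sub>n = y - w\<^sup>n K\<^sup>n y\<close>,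
  so \<open>I - wK\<close> has dense range on the closure of \<open>V\<close>, and is therefore injective there by Riesz's
  theory of compact operators. Compactness of \<open>K\<close> and of the unit circle gives \<open>c > 0\<close> with
  \<open>c \<parallel>x\<parallel> \<le> \<parallel>x - wKx\<parallel>\<close> for all such \<open>w\<close> and all \<open>x\<close> in the closure. Averaging \<open>u\<^sub>n\<close> over the roots of
  unity then yields \<open>c \<parallel>K\<^sup>m y\<parallel> \<le> \<parallel>y - K\<^sup>n y\<parallel>\<close> for \<open>m < n\<close>, hence \<open>c \<parallel>K\<^sup>m y\<parallel> \<le> \<parallel>y\<parallel>\<close> on \<open>V\<close>. So \<open>K\<close>
  is power bounded on \<open>V\<close>, which excludes norm-unimodality, and \<open>K\<^sup>n y \<rightarrow> 0\<close> as soon as this holds along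
  a subsequence, which excludes Li-Yorke pairs.
\<close>

section \<open>Compact operators on a Banach space, in terms of sequences\<close>

locale compact_linear = bounded_linear S for S :: "'a::banach \<Rightarrow> 'a" +
  assumes compact_seq:
    "\<And>x :: nat \<Rightarrow> 'a. bounded (range x) \<Longrightarrow> \<exists>l r. strict_mono r \<and> (\<lambda>n. S (x (r n))) \<longlonglongrightarrow> l"
begin

text \<open>In the splitting \<open>x n = (x n - S (x n)) + S (x n)\<close> the first summand
  converges by hypothesis and the second along a subsequence by compactness; continuity of
  \<open>S\<close> then identifies the limit. Solutions of \<open>z - S z = y\<close> are obtained
  this way below.\<close>

lemma residual_convergent_subseq:
  fixes x :: "nat \<Rightarrow> 'a"
  assumes "bounded (range x)" and "(\<lambda>n. x n - S (x n)) \<longlonglongrightarrow> y"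
  shows "\<exists>z r. strict_mono r \<and> (\<lambda>n. x (r n)) \<longlonglongrightarrow> z \<and> z - S z = y"
proof -
  obtain l r where r: "strict_mono r" and l: "(\<lambda>n. S (x (r n))) \<longlonglongrightarrow> l"
    using compact_seq[OF assms(1)] by blast
  have res: "(\<lambda>n. x (r n) - S (x (r n))) \<longlonglongrightarrow> y"
    using LIMSEQ_subseq_LIMSEQ[OF assms(2) r] by (simp add: o_def)
  from tendsto_add[OF this l] have lim: "(\<lambda>n. x (r n)) \<longlonglongrightarrow> y + l"
    by simp
  from tendsto_diff[OF this tendsto[OF this]] have "(\<lambda>n. x (r n) - S (x (r n))) \<longlonglongrightarrow> y + l - S (y + l)" .
  with res have "y + l - S (y + l) = y"
    using LIMSEQ_unique by blast
  with r lim show ?thesis by blast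
qed

end

section \<open>Closed subspaces and Riesz's lemma\<close>

lemma subspace_closure:
  fixes M :: "'a::real_normed_vector set"
  assumes "subspace M"
  shows "subspace (closure M)"
  unfolding subspace_def
proof (intro conjI ballI allI)
  show "0 \<in> closure M"
    using assms closure_subset subspace_0 by blast
  show "x + y \<in> closure M" if xy: "x \<in> closure M" "y \<in> closure M" for x y
  proof -
    obtain f g where "\<forall>n. f n \<in> M" "f \<longlonglongrightarrow> x" "\<forall>n. g n \<in> M" "g \<longlonglongrightarrow> y"
      using xy unfolding closure_sequential by blast
    then have "(\<lambda>n. f n + g n) \<longlonglongrightarrow> x + y" "\<forall>n. f n + g n \<in> M"
      using assms by (auto intro: tendsto_add subspace_add)
    then show ?thesis unfolding closure_sequential by (intro exI[of _ "\<lambda>n. f n + g n"]) simp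
  qed
  show "r *\<^sub>R x \<in> closure M" if x: "x \<in> closure M" for r x
  proof -
    obtain f where "\<forall>n. f n \<in> M" "f \<longlonglongrightarrow> x"
      using x unfolding closure_sequential by blast
    then have "(\<lambda>n. r *\<^sub>R f n) \<longlonglongrightarrow> r *\<^sub>R x" "\<forall>n. r *\<^sub>R f n \<in> M"
      using assms by (auto intro: tendsto_scaleR subspace_scale)
    then show ?thesis unfolding closure_sequential by (intro exI[of _ "\<lambda>n. r *\<^sub>R f n"]) simp
  qed
qed

text \<open>The distance from \<open>x\<close> to \<open>M\<close> may not be attained, but if it is
  positive some \<open>k\<close> comes within twice that distance. Since \<open>k + m\<close> stays
  in \<open>M\<close>, the distance bounds every \<open>norm (x - k - m)\<close> from below.\<close>

lemma subspace_near_best_approximation: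
  fixes M :: "'a::real_normed_vector set"
  assumes "subspace M" and "closed M"
  shows "\<exists>k\<in>M. \<forall>m\<in>M. norm (x - k) \<le> 2 * norm (x - k - m)"
proof (cases "x \<in> M")
  case True
  then show ?thesis by (intro bexI[of _ x]) auto
next
  case False
  have ne: "M \<noteq> {}" using assms(1) subspace_0 by blast
  have pos: "infdist x M > 0"
    using False assms(2) ne in_closed_iff_infdist_zero[of M x] infdist_nonneg[of x M] by force
  then have "infdist x M < 2 * infdist x M" by simp
  then obtain k where k: "k \<in> M" "dist x k < 2 * infdist x M"
    using ne by (auto simp: infdist_notempty cINF_less_iff)
  have "norm (x - k) \<le> 2 * norm (x - k - m)" if "m \<in> M" for m
  proof -
    have "infdist x M \<le> dist x (k + m)"
      using assms(1) k(1) that by (intro infdist_le subspace_add)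
    then show ?thesis using k(2) by (simp add: dist_norm algebra_simps)
  qed
  with k(1) show ?thesis by blast
qed

text \<open>Riesz's lemma: \<open>M\<close> is closed under scaling, so the near-optimality of
  \<open>k\<close> survives normalization of \<open>x - k\<close>.\<close>

lemma subspace_normalized_far_vector:
  fixes M :: "'a::real_normed_vector set"
  assumes "subspace M" and "k \<in> M" and "\<forall>m\<in>M. norm (x - k) \<le> 2 * norm (x - k - m)"
    and "x \<noteq> k" and "m \<in> M"
  shows "norm ((x - k) /\<^sub>R norm (x - k) - m) \<ge> 1/2"
proof -
  define t where "t = norm (x - k)"
  have t: "t > 0" using assms(4) by (simp add: t_def)
  have "t \<le> 2 * norm (x - k - t *\<^sub>R m)"
    using assms(1,3,5) subspace_scale unfolding t_def by blast
  also have "x - k - t *\<^sub>R m = t *\<^sub>R ((x - k) /\<^sub>R t - m)"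
    using t by (simp add: scaleR_diff_right)
  also have "norm \<dots> = t * norm ((x - k) /\<^sub>R t - m)"
    using t by simp
  finally have "t * 1 \<le> t * (2 * norm ((x - k) /\<^sub>R t - m))" by simp
  then show ?thesis using t unfolding t_def[symmetric] by simp
qed

section \<open>Riesz theory of \<open>I - S\<close> on a closed invariant subspace
  \<open>N\<close>\<close>

context compact_linear
begin

context
  fixes N :: "'a set"
  assumes N: "subspace N" "closed N" and SN: "\<And>x. x \<in> N \<Longrightarrow> S x \<in> N"
begin

lemma bounded_linear_residual: "bounded_linear (\<lambda>x. x - S x)"
  by (intro bounded_linear_sub bounded_linear_ident bounded_linear_axioms)

interpretation A: bounded_linear "\<lambda>x. x - S x"
  by (rule bounded_linear_residual)

text \<open>If every \<open>c\<close> failed, Riesz's lemma would give unit vectors that stay 1/2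
  away from the kernel \<open>M\<close> of \<open>I - S\<close> in \<open>N\<close> while their
  residuals tend to 0. A limit point would lie in \<open>M\<close>, a contradiction. Thus
  \<open>I - S\<close> is bounded below modulo its kernel.\<close>

lemma residual_lower_bound:
  "\<exists>c>0. \<forall>x\<in>N. \<exists>k\<in>N. S k = k \<and> c * norm (x - k) \<le> norm (x - S x)"
proof (rule ccontr)
  define M where "M = {x\<in>N. S x = x}"
  have M: "subspace M"
    using N(1) by (auto simp: M_def subspace_def add scaleR)
  have "M = N \<inter> (\<lambda>x. x - S x) -` {0}" by (auto simp: M_def)
  then have clM: "closed M"
    using N(2) A.continuous_on[OF continuous_on_id] by (simp add: closed_Int closed_vimage)
  assume "\<not> ?thesis"
  then have no: "\<exists>x\<in>N. \<forall>k\<in>M. \<not> c * norm (x - k) \<le> norm (x - S x)" if "c > 0" for c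
    using that by (force simp: M_def)
  have "\<exists>z\<in>N. norm z = 1 \<and> norm (z - S z) \<le> inverse (Suc n) \<and> (\<forall>m\<in>M. norm (z - m) \<ge> 1/2)" for n
  proof -
    obtain x where x: "x \<in> N" "\<And>k. k \<in> M \<Longrightarrow> norm (x - S x) < inverse (Suc n) * norm (x - k)"
      using no[of "inverse (Suc n)"] by (auto simp: not_le)
    obtain k where k: "k \<in> M" "\<forall>m\<in>M. norm (x - k) \<le> 2 * norm (x - k - m)"
      using subspace_near_best_approximation[OF M clM] by blast
    have "x \<noteq> k" using x(2)[OF k(1)] by auto
    define t where "t = norm (x - k)"
    define z where "z = (x - k) /\<^sub>R t"
    have t: "t > 0" using \<open>x \<noteq> k\<close> by (simp add: t_def)
    have "z \<in> N" using N(1) x(1) k(1) by (simp add: z_def M_def subspace_diff subspace_scale)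
    moreover have "norm z = 1" using t by (simp add: z_def t_def)
    moreover have "z - S z = (x - S x) /\<^sub>R t"
      using k(1) by (simp add: z_def M_def scaleR diff scaleR_diff_right)
    then have "norm (z - S z) = norm (x - S x) / t" using t by (simp add: divide_inverse)
    then have "norm (z - S z) \<le> inverse (Suc n)"
      using x(2)[OF k(1)] t by (simp add: t_def[symmetric] pos_divide_le_eq)
    moreover have "\<forall>m\<in>M. norm (z - m) \<ge> 1/2"
      using subspace_normalized_far_vector[OF M k \<open>x \<noteq> k\<close>] unfolding z_def t_def by blast
    ultimately show ?thesis by blast
  qed
  then obtain z where z: "\<And>n. z n \<in> N" "\<And>n. norm (z n) = 1"
    "\<And>n. norm (z n - S (z n)) \<le> inverse (Suc n)" "\<And>n m. m \<in> M \<Longrightarrow> norm (z n - m) \<ge> 1/2"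
    by metis
  have "bounded (range z)" using z(2) by (auto simp: bounded_iff)
  moreover have "(\<lambda>n. z n - S (z n)) \<longlonglongrightarrow> 0"
    by (rule Lim_null_comparison[OF _ LIMSEQ_inverse_real_of_nat]) (use z(3) in simp)
  ultimately obtain l r where lr: "strict_mono r" "(\<lambda>n. z (r n)) \<longlonglongrightarrow> l" "l - S l = 0"
    using residual_convergent_subseq by blast
  have "l \<in> M"
    using closed_sequentially[OF N(2) _ lr(2)] z(1) lr(3) by (simp add: M_def)
  from lr(2) have "(\<lambda>n. norm (z (r n) - l)) \<longlonglongrightarrow> 0"
    by (simp add: LIM_zero tendsto_norm_zero)
  then have "1/2 \<le> (0::real)"
    by (rule LIMSEQ_le_const) (use z(4)[OF \<open>l \<in> M\<close>] in blast)
  then show False by simp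
qed

text \<open>The points \<open>f n\<close> of the range that approximate \<open>y\<close> must have
  bounded preimages before compactness can yield a preimage of \<open>y\<close>. The lower bound
  modulo the kernel supplies them.\<close>

lemma residual_closed_range:
  assumes dense: "N \<subseteq> closure ((\<lambda>x. x - S x) ` N)" and "y \<in> N"
  shows "\<exists>x\<in>N. x - S x = y"
proof -
  obtain c where c: "c > 0" "\<And>x. x \<in> N \<Longrightarrow> \<exists>k\<in>N. S k = k \<and> c * norm (x - k) \<le> norm (x - S x)"
    using residual_lower_bound by blast
  obtain f where f: "\<And>n. f n \<in> (\<lambda>x. x - S x) ` N" "f \<longlonglongrightarrow> y"
    using dense \<open>y \<in> N\<close> closure_sequential by blast
  have "\<exists>x\<in>N. x - S x = f n \<and> c * norm x \<le> norm (f n)" for n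
  proof -
    obtain x where x: "x \<in> N" "f n = x - S x" using f(1) by blast
    obtain k where k: "k \<in> N" "S k = k" "c * norm (x - k) \<le> norm (x - S x)"
      using c(2)[OF x(1)] by blast
    \<comment> \<open>Subtracting the fixed point \<open>k\<close> from \<open>x\<close> leaves the
      residual unchanged.\<close>
    show ?thesis
      using N(1) x k by (intro bexI[of _ "x - k"]) (auto simp: diff subspace_diff)
  qed
  then obtain x where x: "\<And>n. x n \<in> N" "\<And>n. x n - S (x n) = f n" "\<And>n. c * norm (x n) \<le> norm (f n)"
    by metis
  obtain B where B: "\<And>n. norm (f n) \<le> B"
    using convergent_imp_bounded[OF f(2)] by (auto simp: bounded_iff)
  have "norm (x n) \<le> B / c" for n
    using order_trans[OF x(3) B] c(1) by (simp add: field_simps)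
  then have "bounded (range x)" by (auto simp: bounded_iff)
  moreover have "(\<lambda>n. x n - S (x n)) \<longlonglongrightarrow> y" using f(2) by (simp add: x(2))
  ultimately obtain l r where l: "(\<lambda>n. x (r n)) \<longlonglongrightarrow> l" "l - S l = y"
    using residual_convergent_subseq by blast
  have "l \<in> N"
    using closed_sequentially[OF N(2) _ l(1)] x(1) by simp
  with l(2) show ?thesis by blast
qed

text \<open>Dense range is full range by the previous lemma, so a nonzero kernel vector can be
  pulled back through \<open>A = I - S\<close> arbitrarily often. The kernels \<open>M j\<close> of
  the powers of \<open>A\<close> would then increase strictly, and Riesz's lemma would give a
  bounded sequence whose images under \<open>S\<close> are 1/2 apart.\<close>

lemma dense_residual_range_imp_injective:
  assumes dense: "N \<subseteq> closure ((\<lambda>x. x - S x) ` N)" and v: "v \<in> N" "S v = v"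
  shows "v = 0"
proof (rule ccontr)
  assume "v \<noteq> 0"
  define A where "A = (\<lambda>x. x - S x)"
  have blA: "bounded_linear (A ^^ j)" for j
  proof (induction j)
    case (Suc j)
    then show ?case
      using bounded_linear_compose[OF bounded_linear_residual Suc] by (simp add: A_def o_def)
  qed (simp add: id_def bounded_linear_ident)
  have AN: "A x \<in> N" if "x \<in> N" for x
    using that N(1) SN by (simp add: A_def subspace_diff)
  define M where "M j = {x\<in>N. (A ^^ j) x = 0}" for j
  have M: "subspace (M j)" for j
  proof -
    interpret Aj: bounded_linear "A ^^ j" by (rule blA)
    show ?thesis
      using N(1) by (auto simp: M_def subspace_def Aj.add Aj.scaleR Aj.zero)
  qed
  have clM: "closed (M j)" for j
  proof -
    have "M j = N \<inter> (A ^^ j) -` {0}" by (auto simp: M_def)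
    then show ?thesis
      using N(2) bounded_linear.continuous_on[OF blA continuous_on_id]
      by (simp add: closed_Int closed_vimage)
  qed
  have A0: "A 0 = 0" by (simp add: A_def zero)
  have MSuc: "M j \<subseteq> M (Suc j)" for j
    by (auto simp: M_def A0)
  have Mmono: "M i \<subseteq> M j" if "i \<le> j" for i j
    using MSuc that by (rule lift_Suc_mono_le)
  have AM: "A x \<in> M j" if "x \<in> M (Suc j)" for x j
    using that AN by (auto simp: M_def funpow_swap1)
  have SM: "S x \<in> M j" if "x \<in> M j" for x j
  proof -
    have "A x \<in> M j" using AM MSuc that by blast
    then have "x - A x \<in> M j" using M that by (simp add: subspace_diff)
    then show ?thesis by (simp add: A_def)
  qed
  have pre: "\<exists>x\<in>N. (A ^^ j) x = v" for j
  proof (induction j)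
    case 0
    then show ?case using v by auto
  next
    case (Suc j)
    then obtain x where x: "x \<in> N" "(A ^^ j) x = v" by blast
    obtain x' where "x' \<in> N" "A x' = x"
      using residual_closed_range[OF dense x(1)] by (auto simp: A_def)
    then show ?case using x(2) by (auto simp: funpow_swap1 intro!: bexI[of _ x'])
  qed
  have Av: "A v = 0" using v by (simp add: A_def)
  \<comment> \<open>A \<open>j\<close>-fold preimage \<open>x\<close> of \<open>v\<close> lies in
    \<open>M (Suc j)\<close> because \<open>A v = 0\<close>, and outside \<open>M j\<close> because
    \<open>v\<close> is nonzero.\<close>
  have "\<exists>u. u \<in> M (Suc j) \<and> norm u = 1 \<and> (\<forall>m\<in>M j. norm (u - m) \<ge> 1/2)" for j
  proof -
    obtain x where x: "x \<in> N" "(A ^^ j) x = v" using pre by blast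
    obtain k where k: "k \<in> M j" "\<forall>m\<in>M j. norm (x - k) \<le> 2 * norm (x - k - m)"
      using subspace_near_best_approximation[OF M clM] by blast
    have "x \<noteq> k" using x(2) k(1) \<open>v \<noteq> 0\<close> by (auto simp: M_def)
    have "x \<in> M (Suc j)" using x Av by (simp add: M_def)
    then have "(x - k) /\<^sub>R norm (x - k) \<in> M (Suc j)"
      using M[of "Suc j"] k(1) MSuc by (blast intro: subspace_scale subspace_diff)
    moreover have "norm ((x - k) /\<^sub>R norm (x - k)) = 1" using \<open>x \<noteq> k\<close> by simp
    ultimately show ?thesis
      using subspace_normalized_far_vector[OF M k \<open>x \<noteq> k\<close>] by blast
  qed
  then obtain u where u: "\<And>j. u j \<in> M (Suc j)" "\<And>j. norm (u j) = 1"
    "\<And>j m. m \<in> M j \<Longrightarrow> norm (u j - m) \<ge> 1/2"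
    by metis
  \<comment> \<open>Here \<open>S (u j) - S (u i) = u j - (A (u j) + S (u i))\<close>, and the
    bracket lies in \<open>M j\<close>: \<open>A\<close> lowers the index by one, and
    \<open>S\<close> preserves each kernel.\<close>
  have sep: "norm (S (u j) - S (u i)) \<ge> 1/2" if "i < j" for i j
  proof -
    have "S (u i) \<in> M j" using SM[OF u(1)] Mmono[of "Suc i" j] that by auto
    then have "A (u j) + S (u i) \<in> M j" using AM[OF u(1)] M by (simp add: subspace_add)
    from u(3)[OF this] show ?thesis by (simp add: A_def)
  qed
  have "bounded (range u)" using u(2) by (auto simp: bounded_iff)
  then obtain l r where r: "strict_mono r" and l: "(\<lambda>n. S (u (r n))) \<longlonglongrightarrow> l"
    using compact_seq by blast
  from LIMSEQ_imp_Cauchy[OF l] obtain m where "\<And>i j. i \<ge> m \<Longrightarrow> j \<ge> m \<Longrightarrow>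
      norm (S (u (r i)) - S (u (r j))) < 1/2"
    unfolding Cauchy_iff by (metis half_gt_zero zero_less_one)
  from this[of "Suc m" m] sep[of "r m" "r (Suc m)"] r show False
    by (simp add: strict_mono_Suc_iff)
qed

end

end

section \<open>Complex scalar multiplication\<close>

global_interpretation scaleC: vector_space "scaleC :: complex \<Rightarrow> 'a::complex_hilbert_space \<Rightarrow> 'a"
  by (rule vector_space_scaleC)

lemma norm_scaleC: "norm (scaleC a x) = norm a * norm (x :: 'a::complex_hilbert_space)"
proof -
  have "cinner (scaleC a x) (scaleC a x) = a * (cnj a * cinner x x)"
    by (metis cinner_scaleC_left cinner_commute complex_cnj_mult complex_cnj_cnj)
  also have "\<dots> = complex_of_real ((norm a * norm x)\<^sup>2)"
    by (simp add: cinner_self complex_norm_square[symmetric] power_mult_distrib mult.assoc[symmetric])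
  finally have "complex_of_real ((norm (scaleC a x))\<^sup>2) = complex_of_real ((norm a * norm x)\<^sup>2)"
    by (simp only: cinner_self)
  then have "(norm (scaleC a x))\<^sup>2 = (norm a * norm x)\<^sup>2"
    by (simp only: of_real_eq_iff)
  then show ?thesis by simp
qed

lemma bounded_bilinear_scaleC:
  "bounded_bilinear (scaleC :: complex \<Rightarrow> 'a::complex_hilbert_space \<Rightarrow> 'a)"
proof
  fix r :: real and a :: complex and b :: 'a
  show "scaleC (r *\<^sub>R a) b = r *\<^sub>R scaleC a b"
    by (simp add: scaleR_conv_of_real scaleR_scaleC[of r "scaleC a b"] scaleC_scaleC)
  show "scaleC a (r *\<^sub>R b) = r *\<^sub>R scaleC a b"
    by (simp add: scaleR_scaleC[where 'a = 'a] scaleC_scaleC mult.commute)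
  show "\<exists>K. \<forall>a (b::'a). norm (scaleC a b) \<le> norm a * norm b * K"
    by (intro exI[of _ 1]) (simp add: norm_scaleC)
qed (simp_all add: scaleC_add_left scaleC_add_right)

section \<open>Compact operators on a complex Hilbert space and their powers\<close>

locale compact_op =
  fixes K :: "'a::complex_hilbert_space \<Rightarrow> 'a"
  assumes compact_operator: "compact_operator K"
begin

lemma K_add: "K (x + y) = K x + K y" and K_scaleC: "K (scaleC a x) = scaleC a (K x)"
  using compact_operator unfolding compact_operator_def
  by (simp_all add: Vector_Spaces.linear_iff)

text \<open>The image of the unit ball has compact closure, hence is bounded, and homogeneity turns
  this into an operator bound. Compact closures of images of bounded sequences give the convergent
  subsequences.\<close>

lemma compact_linear_K: "compact_linear K"
proof -
  have compact: "compact (closure (K ` B))" if "bounded B" for B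
    using compact_operator that unfolding compact_operator_def by blast
  have scaleR: "K (r *\<^sub>R x) = r *\<^sub>R K x" for r x by (simp add: scaleR_scaleC K_scaleC)
  have "bounded (K ` cball 0 1)"
    using compact_imp_bounded[OF compact[OF bounded_cball]] bounded_subset closure_subset by blast
  then obtain B where B: "\<And>x. norm x \<le> 1 \<Longrightarrow> norm (K x) \<le> B"
    unfolding bounded_iff by (metis image_eqI mem_cball_0)
  have "norm (K x) \<le> norm x * B" for x
  proof (cases "x = 0")
    case True
    then show ?thesis using scaleR[of 0 x] by simp
  next
    case False
    have "norm (K (x /\<^sub>R norm x)) \<le> B" by (rule B) (use False in simp)
    then show ?thesis using False by (simp add: scaleR field_simps)
  qed
  then interpret bounded_linear K
    by (intro bounded_linear_intro) (auto simp: K_add scaleR)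
  show ?thesis
  proof
    fix x :: "nat \<Rightarrow> 'a"
    assume "bounded (range x)"
    then have "seq_compact (closure (K ` range x))"
      using compact compact_imp_seq_compact by blast
    moreover have "\<forall>n. K (x n) \<in> closure (K ` range x)"
      using closure_subset[of "K ` range x"] by auto
    ultimately obtain l r where "strict_mono r" "((\<lambda>n. K (x n)) \<circ> r) \<longlonglongrightarrow> l"
      by (rule seq_compactE)
    then show "\<exists>l r. strict_mono r \<and> (\<lambda>n. K (x (r n))) \<longlonglongrightarrow> l"
      unfolding o_def by blast
  qed
qed

sublocale compact_linear K by (rule compact_linear_K)

lemma compact_linear_scaleC: "compact_linear (\<lambda>x. scaleC w (K x))"
proof -
  note bl = bounded_bilinear.bounded_linear_right[OF bounded_bilinear_scaleC, of w]
  interpret W: bounded_linear "\<lambda>x. scaleC w (K x)"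
    by (rule bounded_linear_compose[OF bl bounded_linear_axioms])
  show ?thesis
  proof
    fix x :: "nat \<Rightarrow> 'a"
    assume "bounded (range x)"
    then obtain l r where "strict_mono r" "(\<lambda>n. K (x (r n))) \<longlonglongrightarrow> l"
      using compact_seq by blast
    then show "\<exists>l r. strict_mono r \<and> (\<lambda>n. scaleC w (K (x (r n)))) \<longlonglongrightarrow> l"
      using bounded_linear.tendsto[OF bl] by blast
  qed
qed

lemma bounded_linear_funpow: "bounded_linear (K ^^ n)"
proof (induction n)
  case (Suc n)
  then show ?case
    using bounded_linear_compose[OF bounded_linear_axioms Suc] by (simp add: o_def)
qed (simp add: id_def bounded_linear_ident)

lemmas funpow_K_0 = linear_0[OF bounded_linear.linear[OF bounded_linear_funpow]]
  and funpow_K_add = linear_add[OF bounded_linear.linear[OF bounded_linear_funpow]]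
  and funpow_K_diff = linear_diff[OF bounded_linear.linear[OF bounded_linear_funpow]]

lemma funpow_K_scaleC: "(K ^^ n) (scaleC a x) = scaleC a ((K ^^ n) x)"
  by (induction n) (simp_all add: K_scaleC)

lemma telescope_residual:
  fixes w y n
  defines "u \<equiv> \<Sum>j<n. scaleC (w ^ j) ((K ^^ j) y)"
  shows "u - scaleC w (K u) = y - scaleC (w ^ n) ((K ^^ n) y)"
proof -
  have "scaleC w (K u) = (\<Sum>j<n. scaleC (w ^ Suc j) ((K ^^ Suc j) y))"
    by (simp add: u_def sum scaleC.scale_sum_right K_scaleC scaleC_scaleC)
  then have "u - scaleC w (K u) =
      (\<Sum>j<n. scaleC (w ^ j) ((K ^^ j) y) - scaleC (w ^ Suc j) ((K ^^ Suc j) y))"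
    by (simp add: u_def sum_subtractf)
  also have "\<dots> = y - scaleC (w ^ n) ((K ^^ n) y)"
    by (subst sum_lessThan_telescope') (simp add: scaleC.scale_one)
  finally show ?thesis .
qed

text \<open>
  Averaging the telescoping sums over the \<open>n\<close>-th roots of unity \<open>w\<close>, weighted by \<open>w\<^sup>-\<^sup>m\<close>, isolates
  the single term \<open>K\<^sup>m y\<close>.
\<close>

lemma funpow_le_of_residual_bound:
  assumes c: "c > 0" and lower: "\<And>w x. norm w = 1 \<Longrightarrow> x \<in> N \<Longrightarrow> c * norm x \<le> norm (x - scaleC w (K x))"
    and N: "\<And>w. (\<Sum>j<n. scaleC (w ^ j) ((K ^^ j) y)) \<in> N" and "m < n"
  shows "c * norm ((K ^^ m) y) \<le> norm (y - (K ^^ n) y)"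
proof -
  define \<omega> where "\<omega> k = cis (2 * pi * real k / real n)" for k
  define u where "u k = (\<Sum>j<n. scaleC (\<omega> k ^ j) ((K ^^ j) y))" for k
  have n: "n > 0" using \<open>m < n\<close> by simp
  have norm1: "norm (\<omega> k) = 1" for k by (simp add: \<omega>_def)
  have root: "\<omega> k ^ n = 1" for k
  proof -
    have "\<omega> k ^ n = cis (real n * (2 * pi * real k / real n))"
      unfolding \<omega>_def by (rule Complex.DeMoivre)
    also have "real n * (2 * pi * real k / real n) = 2 * pi * real k" using n by simp
    also have "cis \<dots> = 1" by (rule cis_multiple_2pi) simp
    finally show ?thesis .
  qed
  \<comment> \<open>The angle \<open>2 * pi * k * j / n\<close> is symmetric in \<open>k\<close> and
    \<open>j\<close>; hence a sum over all roots becomes a geometric sum with one fixed ratio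
    \<open>q\<close>.\<close>
  have swap: "\<omega> k ^ j = \<omega> j ^ k" for k j
    by (simp add: \<omega>_def Complex.DeMoivre algebra_simps)
  \<comment> \<open>Orthogonality of the characters of the cyclic group of order \<open>n\<close>.
    For \<open>j \<noteq> m\<close> the ratio \<open>q\<close> is an \<open>n\<close>-th root of
    unity other than 1, so its geometric sum vanishes.\<close>
  have orth: "(\<Sum>k<n. cnj (\<omega> k ^ m) * \<omega> k ^ j) = (if j = m then of_nat n else 0)" if "j < n" for j
  proof -
    define q where "q = cnj (\<omega> m) * \<omega> j"
    have "(\<Sum>k<n. cnj (\<omega> k ^ m) * \<omega> k ^ j) = (\<Sum>k<n. q ^ k)"
      by (simp add: swap[of _ m] swap[of _ j] q_def power_mult_distrib)
    also have "\<dots> = (if j = m then of_nat n else 0)"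
    proof (cases "j = m")
      case True
      then have "q = 1" by (simp add: q_def \<omega>_def cis_cnj cis_mult)
      with True show ?thesis by simp
    next
      case False
      have "q \<noteq> 1"
      proof
        assume "q = 1"
        then have "\<omega> m * cnj (\<omega> m) * \<omega> j = \<omega> m" by (simp add: q_def mult.assoc)
        moreover have "\<omega> m * cnj (\<omega> m) = 1" by (simp add: \<omega>_def cis_cnj cis_mult)
        ultimately have "\<omega> j = \<omega> m" by simp
        then show False
          using Complex.bij_betw_roots_unity[OF n] \<open>j < n\<close> \<open>m < n\<close> False
          unfolding bij_betw_def inj_on_def \<omega>_def by auto
      qed
      moreover have "q ^ n = 1"
        by (simp add: q_def power_mult_distrib root flip: complex_cnj_power)
      ultimately show ?thesis using False by (simp add: geometric_sum)
    qed
    finally show ?thesis .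
  qed
  have "(\<Sum>k<n. scaleC (cnj (\<omega> k ^ m)) (u k)) =
      (\<Sum>k<n. \<Sum>j<n. scaleC (cnj (\<omega> k ^ m) * \<omega> k ^ j) ((K ^^ j) y))"
    by (simp add: u_def scaleC.scale_sum_right scaleC_scaleC)
  also have "\<dots> = (\<Sum>j<n. scaleC (\<Sum>k<n. cnj (\<omega> k ^ m) * \<omega> k ^ j) ((K ^^ j) y))"
    by (subst sum.swap) (simp only: scaleC.scale_sum_left)
  also have "\<dots> = (\<Sum>j<n. if j = m then scaleC (of_nat n) ((K ^^ j) y) else 0)"
    by (intro sum.cong refl)
      (simp only: lessThan_iff orth if_distrib[of "\<lambda>a. scaleC a _"] scaleC.scale_zero_left)
  also have "\<dots> = scaleC (of_nat n) ((K ^^ m) y)"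
    using \<open>m < n\<close> by simp
  finally have avg: "(\<Sum>k<n. scaleC (cnj (\<omega> k ^ m)) (u k)) = scaleC (of_nat n) ((K ^^ m) y)" .
  have "real n * (c * norm ((K ^^ m) y)) = c * norm (\<Sum>k<n. scaleC (cnj (\<omega> k ^ m)) (u k))"
    unfolding avg by (simp add: norm_scaleC)
  also have "\<dots> \<le> c * (\<Sum>k<n. norm (scaleC (cnj (\<omega> k ^ m)) (u k)))"
    using c by (intro mult_left_mono norm_sum) simp
  also have "\<dots> = (\<Sum>k<n. c * norm (u k))"
    by (simp add: norm_scaleC norm_power norm1 sum_distrib_left)
  also have "\<dots> \<le> (\<Sum>k<n. norm (y - (K ^^ n) y))"
  proof (rule sum_mono)
    fix k
    have "c * norm (u k) \<le> norm (u k - scaleC (\<omega> k) (K (u k)))"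
      unfolding u_def by (rule lower[OF norm1 N])
    \<comment> \<open>Because \<open>\<omega> k ^ n = 1\<close>, the telescoped residual is the same
      vector for every \<open>k\<close>.\<close>
    also have "u k - scaleC (\<omega> k) (K (u k)) = y - (K ^^ n) y"
      unfolding u_def telescope_residual by (simp add: root scaleC.scale_one)
    finally show "c * norm (u k) \<le> norm (y - (K ^^ n) y)" .
  qed
  also have "\<dots> = real n * norm (y - (K ^^ n) y)" by simp
  finally show ?thesis using n by simp
qed

section \<open>Vectors whose orbit tends to 0 along a fixed sequence of times\<close>

definition vanishing :: "(nat \<Rightarrow> nat) \<Rightarrow> 'a set"
  where "vanishing \<sigma> = {y. (\<lambda>n. (K ^^ \<sigma> n) y) \<longlonglongrightarrow> 0}"

lemma vanishing_scaleC: "y \<in> vanishing \<sigma> \<Longrightarrow> scaleC a y \<in> vanishing \<sigma>"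
  using bounded_linear.tendsto_zero[OF bounded_bilinear.bounded_linear_right[OF bounded_bilinear_scaleC, of a]]
  by (simp add: vanishing_def funpow_K_scaleC)

text \<open>The times \<open>\<sigma>\<close> are shared by all vectors, so null sequences can be
  added term by term.\<close>

lemma subspace_vanishing: "subspace (vanishing \<sigma>)"
  unfolding subspace_def
proof (intro conjI ballI allI)
  show "0 \<in> vanishing \<sigma>"
    by (simp add: vanishing_def funpow_K_0)
  show "x + y \<in> vanishing \<sigma>" if "x \<in> vanishing \<sigma>" "y \<in> vanishing \<sigma>" for x y
    using tendsto_add[of "\<lambda>n. (K ^^ \<sigma> n) x" 0 sequentially "\<lambda>n. (K ^^ \<sigma> n) y" 0] that
    by (simp add: vanishing_def funpow_K_add)
  show "r *\<^sub>R x \<in> vanishing \<sigma>" if "x \<in> vanishing \<sigma>" for r x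
    using vanishing_scaleC[OF that] by (simp add: scaleR_scaleC)
qed

lemma vanishing_funpow: "y \<in> vanishing \<sigma> \<Longrightarrow> (K ^^ n) y \<in> vanishing \<sigma>"
proof (induction n)
  case (Suc n)
  have "(K ^^ \<sigma> i) ((K ^^ Suc n) y) = K ((K ^^ \<sigma> i) ((K ^^ n) y))" for i
    by (simp add: funpow_swap1)
  with tendsto_zero[of "\<lambda>i. (K ^^ \<sigma> i) ((K ^^ n) y)" sequentially] Suc show ?case
    by (simp add: vanishing_def)
qed simp

lemma vanishing_sum: "y \<in> vanishing \<sigma> \<Longrightarrow> (\<Sum>j<n. scaleC (w ^ j) ((K ^^ j) y)) \<in> vanishing \<sigma>"
  by (intro subspace_sum subspace_vanishing vanishing_scaleC vanishing_funpow)

lemma closure_vanishing_invariant: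
  assumes "x \<in> closure (vanishing \<sigma>)"
  shows "scaleC w (K x) \<in> closure (vanishing \<sigma>)"
proof -
  interpret W: compact_linear "\<lambda>x. scaleC w (K x)" by (rule compact_linear_scaleC)
  have "(\<lambda>x. scaleC w (K x)) ` closure (vanishing \<sigma>) \<subseteq> closure ((\<lambda>x. scaleC w (K x)) ` vanishing \<sigma>)"
    by (rule closure_bounded_linear_image_subset[OF W.bounded_linear_axioms])
  also have "\<dots> \<subseteq> closure (vanishing \<sigma>)"
    using vanishing_scaleC vanishing_funpow[of _ _ 1] by (intro closure_mono) auto
  finally show ?thesis using assms by blast
qed

text \<open>Since \<open>norm w = 1\<close>, the error \<open>w ^ \<sigma> n\<close> times
  \<open>(K ^^ \<sigma> n) y\<close> in the telescoping identity tends to 0. Hence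
  \<open>I - wK\<close> has dense range on the closure, and Riesz theory applied to
  \<open>wK\<close> gives injectivity.\<close>

lemma no_unimodular_eigenvector:
  assumes w: "norm w = 1" and v: "v \<in> closure (vanishing \<sigma>)" "scaleC w (K v) = v"
  shows "v = 0"
proof -
  let ?V = "vanishing \<sigma>" and ?A = "\<lambda>x. x - scaleC w (K x)"
  interpret W: compact_linear "\<lambda>x. scaleC w (K x)" by (rule compact_linear_scaleC)
  have "y \<in> closure (?A ` ?V)" if y: "y \<in> ?V" for y
  proof -
    have "(\<lambda>n. norm ((K ^^ \<sigma> n) y)) \<longlonglongrightarrow> 0"
      using y by (simp add: vanishing_def tendsto_norm_zero)
    then have "(\<lambda>n. scaleC (w ^ \<sigma> n) ((K ^^ \<sigma> n) y)) \<longlonglongrightarrow> 0"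
      by (subst tendsto_norm_zero_iff[symmetric]) (simp add: norm_scaleC norm_power w)
    from tendsto_diff[OF tendsto_const this, of y]
    have "(\<lambda>n. y - scaleC (w ^ \<sigma> n) ((K ^^ \<sigma> n) y)) \<longlonglongrightarrow> y" by simp
    then have "(\<lambda>n. ?A (\<Sum>j<\<sigma> n. scaleC (w ^ j) ((K ^^ j) y))) \<longlonglongrightarrow> y"
      by (simp only: telescope_residual)
    then show ?thesis
      unfolding closure_sequential using vanishing_sum[OF y]
      by (intro exI[of _ "\<lambda>n. ?A (\<Sum>j<\<sigma> n. scaleC (w ^ j) ((K ^^ j) y))"]) simp
  qed
  then have "closure ?V \<subseteq> closure (?A ` ?V)"
    by (meson closure_minimal closed_closure subsetI)
  also have "\<dots> \<subseteq> closure (?A ` closure ?V)"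
    by (intro closure_mono image_mono closure_subset)
  finally show ?thesis
    using W.dense_residual_range_imp_injective[OF subspace_closure[OF subspace_vanishing]
        closed_closure closure_vanishing_invariant _ v] by blast
qed

text \<open>A failing sequence of unit vectors \<open>x n\<close> and scalars \<open>w n\<close>
  would, by compactness of the circle and of \<open>K\<close>, produce a unit vector fixed by
  \<open>w0 K\<close> in the closure. One \<open>c\<close> has to serve all \<open>w\<close>,
  because the averaging uses the roots of unity of every order.\<close>

lemma unimodular_residual_lower_bound:
  "\<exists>c>0. \<forall>w x. norm w = 1 \<longrightarrow> x \<in> closure (vanishing \<sigma>) \<longrightarrow> c * norm x \<le> norm (x - scaleC w (K x))"
proof (rule ccontr)
  let ?N = "closure (vanishing \<sigma>)"
  assume "\<not> ?thesis"
  then have no: "\<exists>w x. norm w = 1 \<and> x \<in> ?N \<and> norm (x - scaleC w (K x)) < c * norm x" if "c > 0" for c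
    using that by (meson not_le)
  have "\<exists>w x. norm w = 1 \<and> x \<in> ?N \<and> norm x = 1 \<and> norm (x - scaleC w (K x)) \<le> inverse (Suc n)" for n
  proof -
    obtain w x where x: "norm w = 1" "x \<in> ?N" "norm (x - scaleC w (K x)) < inverse (Suc n) * norm x"
      using no[of "inverse (Suc n)"] by auto
    interpret W: compact_linear "\<lambda>x. scaleC w (K x)" by (rule compact_linear_scaleC)
    have "x \<noteq> 0" using x(3) by auto
    define z where "z = x /\<^sub>R norm x"
    have "z \<in> ?N" using x(2) by (simp add: z_def subspace_scale subspace_closure subspace_vanishing)
    moreover have "z - scaleC w (K z) = (x - scaleC w (K x)) /\<^sub>R norm x"
      by (simp add: z_def W.scaleR scaleR_diff_right)
    then have "norm (z - scaleC w (K z)) = norm (x - scaleC w (K x)) / norm x"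
      by (simp add: divide_inverse)
    then have "norm (z - scaleC w (K z)) \<le> inverse (Suc n)"
      using x(3) \<open>x \<noteq> 0\<close> by (simp add: pos_divide_le_eq)
    ultimately show ?thesis using x(1) \<open>x \<noteq> 0\<close> by (intro exI[of _ w] exI[of _ z]) (simp add: z_def)
  qed
  then obtain w x where x: "\<And>n. norm (w n :: complex) = 1" "\<And>n. x n \<in> ?N" "\<And>n. norm (x n) = 1"
    "\<And>n. norm (x n - scaleC (w n) (K (x n))) \<le> inverse (Suc n)"
    by metis
  have "seq_compact (sphere (0::complex) 1)" by (simp add: compact_imp_seq_compact)
  then obtain w0 r where w0: "norm w0 = 1" "strict_mono r" "(w \<circ> r) \<longlonglongrightarrow> w0"
    using x(1) unfolding seq_compact_def by (metis mem_sphere_0)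
  have lim: "(\<lambda>n. x n - scaleC (w n) (K (x n))) \<longlonglongrightarrow> 0"
    by (rule Lim_null_comparison[OF _ LIMSEQ_inverse_real_of_nat]) (use x(4) in simp)
  obtain B where B: "\<And>x. norm (K x) \<le> norm x * B" using bounded by blast
  have bound0: "(\<lambda>n. norm (w (r n) - w0) * B) \<longlonglongrightarrow> 0"
    using tendsto_mult_right[OF tendsto_norm_zero[OF LIM_zero[OF w0(3)]], of B] by simp
  have "norm (scaleC (w (r n) - w0) (K (x (r n)))) \<le> norm (w (r n) - w0) * B" for n
    using B[of "x (r n)"] x(3) by (simp add: norm_scaleC mult_left_mono)
  then have "(\<lambda>n. scaleC (w (r n) - w0) (K (x (r n)))) \<longlonglongrightarrow> 0"
    by (rule Lim_null_comparison[OF always_eventually[OF allI] bound0])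
  \<comment> \<open>Adding the null sequence replaces the moving scalar \<open>w (r n)\<close> by
    its limit \<open>w0\<close>, so compactness of the single operator \<open>w0 K\<close>
    applies.\<close>
  from tendsto_add[OF LIMSEQ_subseq_LIMSEQ[OF lim w0(2)] this]
  have "(\<lambda>n. x (r n) - scaleC w0 (K (x (r n)))) \<longlonglongrightarrow> 0"
    by (simp add: o_def scaleC.scale_left_diff_distrib)
  moreover have "bounded (range (\<lambda>n. x (r n)))" using x(3) by (auto simp: bounded_iff)
  ultimately obtain l s where l: "(\<lambda>n. x (r (s n))) \<longlonglongrightarrow> l" "l - scaleC w0 (K l) = 0"
    using compact_linear.residual_convergent_subseq[OF compact_linear_scaleC[of w0], of "\<lambda>n. x (r n)" 0]
    by blast
  have "l \<in> ?N" using closed_sequentially[OF closed_closure _ l(1)] x(2) by simp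
  then have "l = 0" using no_unimodular_eigenvector[OF w0(1)] l(2) by simp
  with tendsto_norm[OF l(1)] x(3) show False
    by (simp add: LIMSEQ_const_iff)
qed

text \<open>For fixed \<open>m\<close> the averaged estimate holds at all times
  \<open>\<sigma> n > m\<close>, and its right-hand side tends to \<open>norm y\<close>; the
  constant is \<open>C = 1 / c\<close>.\<close>

lemma power_bounded_on_vanishing:
  assumes \<sigma>: "filterlim \<sigma> at_top sequentially"
  shows "\<exists>C>0. \<forall>y\<in>vanishing \<sigma>. \<forall>m. norm ((K ^^ m) y) \<le> C * norm y"
proof -
  obtain c where c: "c > 0" and lower: "\<And>w x. norm w = 1 \<Longrightarrow> x \<in> closure (vanishing \<sigma>) \<Longrightarrow>
      c * norm x \<le> norm (x - scaleC w (K x))"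
    using unimodular_residual_lower_bound by blast
  have "norm ((K ^^ m) y) \<le> inverse c * norm y" if y: "y \<in> vanishing \<sigma>" for y m
  proof -
    have "(\<lambda>n. (K ^^ \<sigma> n) y) \<longlonglongrightarrow> 0" using y by (simp add: vanishing_def)
    from tendsto_norm[OF tendsto_diff[OF tendsto_const this]]
    have "(\<lambda>n. norm (y - (K ^^ \<sigma> n) y)) \<longlonglongrightarrow> norm y" by simp
    moreover have "eventually (\<lambda>n. m < \<sigma> n) sequentially"
      using eventually_compose_filterlim[OF eventually_gt_at_top \<sigma>] by simp
    then have "eventually (\<lambda>n. c * norm ((K ^^ m) y) \<le> norm (y - (K ^^ \<sigma> n) y)) sequentially"
    proof eventually_elim
      case (elim n)
      show ?case
        by (rule funpow_le_of_residual_bound[OF c lower _ elim])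
          (assumption | rule subsetD[OF closure_subset vanishing_sum[OF y]])+
    qed
    ultimately have "c * norm ((K ^^ m) y) \<le> norm y"
      by (rule tendsto_lowerbound) simp
    then show ?thesis using c by (simp add: field_simps)
  qed
  then show ?thesis using c by (intro exI[of _ "inverse c"]) simp
qed

text \<open>Once a single iterate at time \<open>\<sigma> j\<close> is smaller than
  \<open>e / C\<close>, power boundedness keeps all later iterates below \<open>e\<close>, because
  that iterate is itself in \<open>vanishing \<sigma>\<close>.\<close>

lemma vanishing_imp_tendsto_0:
  assumes \<sigma>: "filterlim \<sigma> at_top sequentially" and y: "y \<in> vanishing \<sigma>"
  shows "(\<lambda>n. (K ^^ n) y) \<longlonglongrightarrow> 0"
proof (rule LIMSEQ_I)
  fix e :: real
  assume "e > 0"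
  obtain C where C: "C > 0" "\<And>y m. y \<in> vanishing \<sigma> \<Longrightarrow> norm ((K ^^ m) y) \<le> C * norm y"
    using power_bounded_on_vanishing[OF \<sigma>] by blast
  obtain j where j: "norm ((K ^^ \<sigma> j) y) < e / C"
    using LIMSEQ_D[of "\<lambda>n. (K ^^ \<sigma> n) y" 0 "e / C"] y C(1) \<open>e > 0\<close>
    by (auto simp: vanishing_def)
  have "norm ((K ^^ n) y) < e" if "n \<ge> \<sigma> j" for n
  proof -
    have "(K ^^ n) y = (K ^^ (n - \<sigma> j)) ((K ^^ \<sigma> j) y)"
      using that by (simp flip: funpow_add[unfolded o_def, THEN fun_cong])
    also have "norm \<dots> \<le> C * norm ((K ^^ \<sigma> j) y)"
      by (rule C(2)[OF vanishing_funpow[OF y]])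
    also have "\<dots> < e" using j C(1) by (simp add: field_simps)
    finally show ?thesis .
  qed
  then show "\<exists>no. \<forall>n\<ge>no. norm ((K ^^ n) y - 0) < e" by auto
qed

section \<open>Absence of Li-Yorke pairs and of norm-unimodality\<close>

lemma not_li_yorke_pair: "\<not> li_yorke_pair K x y"
proof
  assume ly: "li_yorke_pair K x y"
  let ?d = "\<lambda>n. ereal (dist ((K ^^ n) x) ((K ^^ n) y))"
  have d: "dist ((K ^^ n) x) ((K ^^ n) y) = norm ((K ^^ n) (x - y))" for n
    by (simp add: dist_norm funpow_K_diff)
  \<comment> \<open>A subsequence realizing the lower limit 0 puts \<open>x - y\<close> into
    \<open>vanishing \<sigma>\<close>; the whole orbit distance then tends to 0.\<close>
  obtain \<sigma> where \<sigma>: "strict_mono \<sigma>" "(?d \<circ> \<sigma>) \<longlonglongrightarrow> liminf ?d"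
    using liminf_subseq_lim by blast
  then have "(\<lambda>n. ereal (norm ((K ^^ \<sigma> n) (x - y)))) \<longlonglongrightarrow> ereal 0"
    using ly by (simp add: li_yorke_pair_def o_def d zero_ereal_def)
  then have "x - y \<in> vanishing \<sigma>"
    by (simp add: vanishing_def tendsto_norm_zero_iff)
  then have "(\<lambda>n. (K ^^ n) (x - y)) \<longlonglongrightarrow> 0"
    using vanishing_imp_tendsto_0 filterlim_subseq[OF \<sigma>(1)] by blast
  then have "?d \<longlonglongrightarrow> ereal 0"
    unfolding d by (simp add: tendsto_norm_zero_iff)
  then have "limsup ?d = 0"
    by (simp add: lim_imp_Limsup zero_ereal_def)
  with ly show False by (simp add: li_yorke_pair_def)
qed

lemma not_norm_unimodal: "\<not> norm_unimodal K"
proof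
  assume "norm_unimodal K"
  then obtain r where r: "r > 1" and *: "\<And>m. \<exists>x. x \<noteq> 0 \<and> (\<lambda>k. norm ((K ^^ k) x)) \<longlonglongrightarrow> 0 \<and>
      (\<forall>i\<in>{1..m}. norm ((K ^^ i) x) \<ge> r ^ i * norm x)"
    unfolding norm_unimodal_def by blast
  obtain C where C: "\<And>y m. y \<in> vanishing (\<lambda>n. n) \<Longrightarrow> norm ((K ^^ m) y) \<le> C * norm y"
    using power_bounded_on_vanishing[OF filterlim_ident] by blast
  obtain m where m: "C < r ^ m" using real_arch_pow[OF r] by blast
  \<comment> \<open>The growth condition starts at index 1, whereas \<open>m\<close> may be 0; hence
    the passage to \<open>Suc m\<close>.\<close>
  have "C < r ^ Suc m" using m power_increasing[of m "Suc m" r] r by linarith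
  obtain x where x: "x \<noteq> 0" "(\<lambda>k. norm ((K ^^ k) x)) \<longlonglongrightarrow> 0" "r ^ Suc m * norm x \<le> norm ((K ^^ Suc m) x)"
    using *[of "Suc m"] by fastforce
  have "x \<in> vanishing (\<lambda>n. n)"
    using x(2) by (simp add: vanishing_def tendsto_norm_zero_iff)
  from order_trans[OF x(3) C[OF this]] have "r ^ Suc m \<le> C" using x(1) by simp
  with \<open>C < r ^ Suc m\<close> show False by simp
qed

end

section \<open>Distributional chaos implies Li-Yorke chaos\<close>

lemma limsup_le_of_eventually:
  fixes f :: "nat \<Rightarrow> ereal"
  assumes "eventually (\<lambda>n. f n \<le> g n) sequentially" "g \<longlonglongrightarrow> l"
  shows "limsup f \<le> l"
  using Limsup_mono[OF assms(1)] lim_imp_Limsup[OF _ assms(2)] by simp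

text \<open>Nonzero upper density of the times with \<open>d n < t\<close>, for every
  \<open>t > 0\<close>, forces infinitely many such times and so lower limit 0. Lower density 0 of
  the times with \<open>d n < e\<close> forces infinitely many times with \<open>d n \<ge> e\<close>
  and so a positive upper limit.\<close>

lemma distributionally_chaotic_pair_imp_li_yorke_pair:
  assumes "distributionally_chaotic_pair f x y"
  shows "li_yorke_pair f x y"
proof -
  define d where "d n = dist ((f ^^ n) x) ((f ^^ n) y)" for n
  have freq: "orbit_freq f x y n t = real (card {i. i < n \<and> d i < t}) / real n" for n t
    by (simp add: orbit_freq_def d_def)
  have upper: "limsup (\<lambda>n. ereal (orbit_freq f x y n t)) = 1" if "t > 0" for t
    using assms that by (simp add: distributionally_chaotic_pair_def upper_distribution_def)
  obtain e where e: "e > 0" "liminf (\<lambda>n. ereal (orbit_freq f x y n e)) = 0"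
    using assms by (auto simp: distributionally_chaotic_pair_def lower_distribution_def)
  have often_small: "\<exists>\<^sub>F n in sequentially. d n < t" if t: "t > 0" for t
  proof (rule ccontr)
    assume "\<not> ?thesis"
    then obtain k where k: "\<And>n. n \<ge> k \<Longrightarrow> \<not> d n < t"
      by (auto simp: frequently_def eventually_sequentially)
    \<comment> \<open>Only indices below \<open>k\<close> are counted. At \<open>n = 0\<close> both
      sides are 0 by division by zero.\<close>
    have "orbit_freq f x y n t \<le> real k / real n" for n
    proof -
      have "{i. i < n \<and> d i < t} \<subseteq> {..<k}" using k by (auto simp: not_le[symmetric])
      from card_mono[OF _ this] show ?thesis by (simp add: freq divide_right_mono)
    qed
    then have "eventually (\<lambda>n. ereal (orbit_freq f x y n t) \<le> ereal (real k / real n)) sequentially"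
      by simp
    moreover have "(\<lambda>n. ereal (real k / real n)) \<longlonglongrightarrow> ereal 0"
      by (simp add: lim_const_over_n)
    ultimately have "limsup (\<lambda>n. ereal (orbit_freq f x y n t)) \<le> ereal 0"
      by (rule limsup_le_of_eventually)
    with upper[OF t] show False by simp
  qed
  have often_large: "\<exists>\<^sub>F n in sequentially. d n \<ge> e"
  proof (rule ccontr)
    assume "\<not> ?thesis"
    then have "eventually (\<lambda>n. d n < e) sequentially"
      by (simp add: frequently_def not_le)
    then obtain k where k: "\<And>n. n \<ge> k \<Longrightarrow> d n < e"
      unfolding eventually_sequentially by blast
    \<comment> \<open>At \<open>n = 0\<close> the left side would be 1 and the frequency 0, so this
      bound needs \<open>n > 0\<close>.\<close>
    have "1 - real k / real n \<le> orbit_freq f x y n e" if "n > 0" for n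
    proof -
      have "{k..<n} \<subseteq> {i. i < n \<and> d i < e}" using k by auto
      from card_mono[OF _ this] have "real n - real k \<le> real (card {i. i < n \<and> d i < e})" by simp
      from divide_right_mono[OF this, of "real n"] show ?thesis
        using that by (simp add: freq diff_divide_distrib)
    qed
    then have "eventually (\<lambda>n. ereal (1 - real k / real n) \<le> ereal (orbit_freq f x y n e)) sequentially"
      by (auto simp: eventually_sequentially intro!: exI[of _ 1])
    from Liminf_mono[OF this] have "liminf (\<lambda>n. ereal (1 - real k / real n)) \<le> 0"
      by (simp add: e(2))
    moreover have "(\<lambda>n. ereal (1 - real k / real n)) \<longlonglongrightarrow> ereal (1 - 0)"
      by (intro tendsto_ereal tendsto_diff tendsto_const lim_const_over_n)
    then have "liminf (\<lambda>n. ereal (1 - real k / real n)) = ereal 1"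
      by (simp add: lim_imp_Liminf)
    ultimately show False by simp
  qed
  have "limsup (\<lambda>n. ereal (d n)) > 0"
  proof (rule ccontr)
    assume "\<not> ?thesis"
    then have "limsup (\<lambda>n. ereal (d n)) < ereal e" using e(1) by (simp add: not_less le_less_trans)
    from Limsup_lessD[OF this] have "eventually (\<lambda>n. d n < e) sequentially" by simp
    then show False using often_large by (simp add: frequently_def not_le)
  qed
  moreover have "liminf (\<lambda>n. ereal (d n)) = 0"
  proof (rule antisym)
    show "0 \<le> liminf (\<lambda>n. ereal (d n))"
      by (rule Liminf_bounded) (simp add: d_def)
    show "liminf (\<lambda>n. ereal (d n)) \<le> 0"
    proof (rule ccontr)
      assume "\<not> ?thesis"
      then have "0 < liminf (\<lambda>n. ereal (d n))" by simp
      then obtain t where t: "ereal 0 < ereal t" "ereal t < liminf (\<lambda>n. ereal (d n))"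
        using ereal_dense2 by (metis zero_ereal_def)
      from less_LiminfD[OF t(2)] have "eventually (\<lambda>n. t < d n) sequentially" by simp
      then have "eventually (\<lambda>n. \<not> d n < t) sequentially"
        by (rule eventually_mono) simp
      then show False using often_small[of t] t(1) by (simp add: frequently_def)
    qed
  qed
  ultimately show ?thesis by (simp add: li_yorke_pair_def d_def)
qed

lemma distributionally_chaotic_imp_li_yorke_chaotic:
  "distributionally_chaotic f \<Longrightarrow> li_yorke_chaotic f"
  unfolding distributionally_chaotic_def li_yorke_chaotic_def
  using distributionally_chaotic_pair_imp_li_yorke_pair by blast

theorem proposition3p2:
  fixes K :: "'a::complex_hilbert_space \<Rightarrow> 'a"
  assumes "compact_operator K"
  shows "\<not> li_yorke_chaotic K \<and> \<not> distributionally_chaotic K \<and> \<not> norm_unimodal K"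
proof -
  interpret compact_op K by unfold_locales (rule assms)
  have "\<not> li_yorke_chaotic K"
  proof
    assume "li_yorke_chaotic K"
    then obtain \<Gamma> :: "'a set" where "uncountable \<Gamma>" and "\<And>x y. x \<in> \<Gamma> \<Longrightarrow> y \<in> \<Gamma> \<Longrightarrow> x = y"
      unfolding li_yorke_chaotic_def using not_li_yorke_pair by blast
    \<comment> \<open>Without Li-Yorke pairs, any two points of \<open>\<Gamma>\<close>
      coincide.\<close>
    then have "\<exists>x. \<Gamma> \<subseteq> {x}" by blast
    then show False using \<open>uncountable \<Gamma>\<close> by (metis countable_subset countable_finite finite.simps)
  qed
  then show ?thesis
    using distributionally_chaotic_imp_li_yorke_chaotic not_norm_unimodal by blast
qed

end
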